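(* Let $n$ be a positive integer and let $D_n$ be a maximal Diophantine graph of order $n$ with Diophantine labelling $f$. For any two distinct vertices $u,v$ of $D_n$, $uv\notin E(D_n)$ if and only if there exists a prime number $p$ such that $f(u), f(v)\in M_{p^{\acute{v}_{p}(n)}}$.
   Context: All graphs are finite, simple and undirected, and $(a,b)$ denotes the greatest common divisor of $a$ and $b$. A graph $G=(V,E)$ of order $n$ is a Diophantine graph if there is a bijection $f:V\to\{1,2,\dots,n\}$ (a Diophantine labelling) such that $(f(u),f(v))\mid n$ for all $uv\in E$. It is a maximal Diophantine graph, denoted $(D_n,f)$ or simply $D_n$, if adding any new edge turns it into a non-Diophantine graph; thus two distinct vertices $u,v$ of $D_n$ are adjacent if and only if $(f(u),f(v))\mid n$. For a prime $p$, $v_p(n)$ is the $p$-adic valuation of $n$, and $\acute{v}_p(n):=v_p(n)+1$. For a positive integer $a$, $M_a:=\{ka : k=1,2,\dots,\lfloor n/a\rfloor\}$ is the set of multiples of $a$ up to $n$. *)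

theory Defs
  imports "HOL-Computational_Algebra.Primes"
begin

text \<open>
  A graph is given by its vertex set and its set of edges, where the edge \<open>uv\<close> is
  the two-element set \<open>{u, v}\<close>; loops and multiple edges are thereby excluded.
\<close>

definition simple_graph :: "'a set \<Rightarrow> 'a set set \<Rightarrow> bool" where
  "simple_graph V E \<longleftrightarrow>
     finite V \<and> (\<forall>e\<in>E. \<exists>u\<in>V. \<exists>v\<in>V. u \<noteq> v \<and> e = {u, v})"

definition diophantine_labelling :: "'a set \<Rightarrow> 'a set set \<Rightarrow> ('a \<Rightarrow> nat) \<Rightarrow> bool" where
  "diophantine_labelling V E f \<longleftrightarrow>
     bij_betw f V {1..card V} \<and>
     (\<forall>u\<in>V. \<forall>v\<in>V. {u, v} \<in> E \<longrightarrow> gcd (f u) (f v) dvd card V)"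

definition diophantine_graph :: "'a set \<Rightarrow> 'a set set \<Rightarrow> bool" where
  "diophantine_graph V E \<longleftrightarrow> simple_graph V E \<and> (\<exists>f. diophantine_labelling V E f)"

text \<open>
  Adding a new edge must destroy every Diophantine labelling, not only a given one.
  That adjacency in such a graph is equivalent to the divisibility condition, for any of its
  Diophantine labellings, is a consequence and not part of the definition.
\<close>

definition maximal_diophantine_graph :: "'a set \<Rightarrow> 'a set set \<Rightarrow> bool" where
  "maximal_diophantine_graph V E \<longleftrightarrow>
     diophantine_graph V E \<and>
     (\<forall>u\<in>V. \<forall>v\<in>V. u \<noteq> v \<and> {u, v} \<notin> E \<longrightarrow> \<not> diophantine_graph V (insert {u, v} E))"

text \<open>On natural numbers, \<open>n div a\<close> is the floor of the quotient of \<open>n\<close> by \<open>a\<close>.\<close>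

definition multiples_upto :: "nat \<Rightarrow> nat \<Rightarrow> nat set" where
  "multiples_upto n a = {k * a | k. k \<in> {1..n div a}}"

end

theory Submission
  imports Defs
begin

text \<open>Maximality turns adjacency into arithmetic: by
  \<open>maximal_diophantine_graph_edge_iff\<close>, a missing edge means that the gcd
  \<open>d\<close> of the two labels does not divide \<open>n\<close>. By
  \<open>not_dvd_iff_prime_power_dvd\<close>, this happens exactly when some prime \<open>p\<close>
  has a larger exponent in \<open>d\<close> than in \<open>n\<close>, so that
  \<open>p ^ (multiplicity p n + 1)\<close> divides \<open>d\<close>, equivalently both labels. As
  labels lie in \<open>{1..n}\<close>, this divisibility is membership in the set of
  multiples.\<close>

lemma mem_multiples_upto_iff:
  assumes "a > 0"
  shows "x \<in> multiples_upto n a \<longleftrightarrow> x \<in> {1..n} \<and> a dvd x"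
proof
  assume "x \<in> multiples_upto n a"
  then obtain k where k: "x = k * a" "1 \<le> k" "k \<le> n div a"
    by (auto simp: multiples_upto_def)
  from assms k have "k * a \<le> n"
    by (simp add: less_eq_div_iff_mult_less_eq)
  with assms k show "x \<in> {1..n} \<and> a dvd x"
    by simp
next
  assume x: "x \<in> {1..n} \<and> a dvd x"
  then obtain k where k: "x = k * a"
    by (metis dvd_def mult.commute)
  with assms x have "k \<le> n div a"
    by (simp add: less_eq_div_iff_mult_less_eq)
  moreover from k x have "1 \<le> k"
    by (cases k) auto
  ultimately show "x \<in> multiples_upto n a"
    using k by (auto simp: multiples_upto_def)
qed

text \<open>Divisibility of positive integers is comparison of valuations at every prime, so its
  failure is witnessed by one prime; the \<open>+ 1\<close> expresses the strict excess.\<close>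

lemma not_dvd_iff_prime_power_dvd:
  fixes d n :: nat
  assumes "d > 0" and "n > 0"
  shows "\<not> d dvd n \<longleftrightarrow> (\<exists>p. prime p \<and> p ^ (multiplicity p n + 1) dvd d)"
proof -
  have "d dvd n \<longleftrightarrow> (\<forall>p. prime p \<longrightarrow> multiplicity p d \<le> multiplicity p n)"
    using assms by (auto intro: multiplicity_le_imp_dvd dvd_imp_multiplicity_le)
  moreover have "p ^ (multiplicity p n + 1) dvd d \<longleftrightarrow> \<not> multiplicity p d \<le> multiplicity p n"
    if "prime p" for p
    using assms that
    by (subst power_dvd_iff_le_multiplicity) (auto simp: not_le Suc_le_eq dest: not_prime_unit)
  ultimately show ?thesis
    by blast
qed

text \<open>If the gcd divides the order, \<open>f\<close> survives the insertion of
  \<open>{u, v}\<close>; one surviving labelling contradicts maximality unless the edge was already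
  present.\<close>

lemma maximal_diophantine_graph_edge_iff:
  assumes max: "maximal_diophantine_graph V E"
    and lab: "diophantine_labelling V E f"
    and uv: "u \<in> V" "v \<in> V" "u \<noteq> v"
  shows "{u, v} \<in> E \<longleftrightarrow> gcd (f u) (f v) dvd card V"
proof
  assume "{u, v} \<in> E"
  with lab uv show "gcd (f u) (f v) dvd card V"
    by (auto simp: diophantine_labelling_def)
next
  assume dvd: "gcd (f u) (f v) dvd card V"
  have "simple_graph V (insert {u, v} E)"
    using max uv
    by (auto simp: maximal_diophantine_graph_def diophantine_graph_def simple_graph_def)
  \<comment> \<open>The inserted edge may be read as \<open>{v, u}\<close>, hence the symmetry of
    gcd.\<close>
  moreover have "diophantine_labelling V (insert {u, v} E) f"
    using lab dvd by (auto simp: diophantine_labelling_def doubleton_eq_iff gcd.commute)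
  ultimately have "diophantine_graph V (insert {u, v} E)"
    by (auto simp: diophantine_graph_def)
  with max uv show "{u, v} \<in> E"
    by (auto simp: maximal_diophantine_graph_def)
qed

theorem lemma3p1:
  fixes n :: nat and V :: "'a set" and E :: "'a set set" and f :: "'a \<Rightarrow> nat" and u v :: 'a
  assumes "n > 0"
    and "card V = n"
    and "maximal_diophantine_graph V E"
    and "diophantine_labelling V E f"
    and "u \<in> V" and "v \<in> V" and "u \<noteq> v"
  shows "{u, v} \<notin> E \<longleftrightarrow>
    (\<exists>p::nat. prime p \<and>
       f u \<in> multiples_upto n (p ^ (multiplicity p n + 1)) \<and>
       f v \<in> multiples_upto n (p ^ (multiplicity p n + 1)))"
proof -
  \<comment> \<open>The lower bound makes the gcd positive, as the valuation criterion requires;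
    both bounds are needed to pass from divisibility to membership.\<close>
  have range: "f u \<in> {1..n}" "f v \<in> {1..n}"
    using assms by (auto simp: diophantine_labelling_def dest: bij_betwE)
  have "{u, v} \<notin> E \<longleftrightarrow> \<not> gcd (f u) (f v) dvd n"
    using maximal_diophantine_graph_edge_iff[OF assms(3-7)] assms(2) by simp
  also have "\<dots> \<longleftrightarrow> (\<exists>p. prime p \<and> p ^ (multiplicity p n + 1) dvd gcd (f u) (f v))"
    using assms(1) range by (intro not_dvd_iff_prime_power_dvd) auto
  also have "\<dots> \<longleftrightarrow> (\<exists>p. prime p \<and>
       f u \<in> multiples_upto n (p ^ (multiplicity p n + 1)) \<and>
       f v \<in> multiples_upto n (p ^ (multiplicity p n + 1)))"
  proof -
    have "p ^ (multiplicity p n + 1) > 0" if "prime p" for p :: nat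
      using that by (simp add: prime_gt_0_nat)
    with range show ?thesis
      by (metis mem_multiples_upto_iff gcd_greatest_iff)
  qed
  finally show ?thesis .
qed

end
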